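(* Let $G$ be a locally compact second countable abelian group with Haar measure $\mu$, let $f:G\to\mathbb{C}$ be a measurable function and let $\varphi=Nf$, that is, $\varphi(s,t)=f(s-t)$ for $s,t\in G$. The function $\varphi$ is equivalent (equal $\mu\times\mu$-almost everywhere) to an $\omega$-continuous function if and only if $f$ is equivalent (equal $\mu$-almost everywhere) to a continuous function. Moreover, $\varphi$ is $\omega$-continuous if and only if $f$ is continuous.
   Context: On $G\times G$ (with $\mu$ on each factor): a rectangle is a set $\alpha\times\beta$ with $\alpha,\beta\subseteq G$ measurable; a set is marginally null if it is contained in $(X_0\times G)\cup(G\times Y_0)$ with $\mu(X_0)=\mu(Y_0)=0$; a set is $\omega$-open if its symmetric difference with some countable union of rectangles is marginally null. A measurable function $g:G\times G\to\mathbb{C}$ is $\omega$-continuous if $g^{-1}(U)$ is $\omega$-open for every open $U\subseteq\mathbb{C}$. *)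

theory Defs
  imports "HOL-Analysis.Analysis"
begin

definition haar_measure ::
    "'a :: {topological_ab_group_add, second_countable_topology, t2_space} measure \<Rightarrow> bool" where
  "haar_measure \<mu> \<longleftrightarrow>
     sets \<mu> = sets borel \<and>
     emeasure \<mu> UNIV \<noteq> 0 \<and>
     (\<forall>K. compact K \<longrightarrow> emeasure \<mu> K < \<infinity>) \<and>
     (\<forall>A \<in> sets borel. emeasure \<mu> A = (INF U \<in> {U. open U \<and> A \<subseteq> U}. emeasure \<mu> U)) \<and>
     (\<forall>U. open U \<longrightarrow> emeasure \<mu> U = (SUP K \<in> {K. compact K \<and> K \<subseteq> U}. emeasure \<mu> K)) \<and>
     (\<forall>x. \<forall>A \<in> sets borel. emeasure \<mu> ((+) x ` A) = emeasure \<mu> A)"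

text \<open>
  Below, \<open>\<mu>\<close> is a Borel measure on the whole type, and \<open>measurable\<close> is understood in the sense
  of Haar (Lebesgue) measurability, that is, with respect to the completion of the
  Borel measure. In particular all Borel sets and Borel functions are measurable. The
  measurable subsets of the product are those of the completion of \<open>\<mu> \<Otimes>\<^sub>M \<mu>\<close>.
\<close>

definition rectangles :: "'a measure \<Rightarrow> ('a \<times> 'a) set set" where
  "rectangles \<mu> = {\<alpha> \<times> \<beta> | \<alpha> \<beta>. \<alpha> \<in> sets (completion \<mu>) \<and> \<beta> \<in> sets (completion \<mu>)}"

definition marginally_null :: "'a measure \<Rightarrow> ('a \<times> 'a) set \<Rightarrow> bool" where
  "marginally_null \<mu> E \<longleftrightarrow>
     (\<exists>X\<^sub>0 \<in> null_sets (completion \<mu>). \<exists>Y\<^sub>0 \<in> null_sets (completion \<mu>).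
        E \<subseteq> (X\<^sub>0 \<times> UNIV) \<union> (UNIV \<times> Y\<^sub>0))"

definition omega_open :: "'a measure \<Rightarrow> ('a \<times> 'a) set \<Rightarrow> bool" where
  "omega_open \<mu> E \<longleftrightarrow>
     (\<exists>\<R>. countable \<R> \<and> \<R> \<subseteq> rectangles \<mu> \<and> marginally_null \<mu> ((E - \<Union>\<R>) \<union> (\<Union>\<R> - E)))"

definition omega_continuous :: "'a measure \<Rightarrow> ('a \<times> 'a \<Rightarrow> complex) \<Rightarrow> bool" where
  "omega_continuous \<mu> g \<longleftrightarrow>
     g \<in> borel_measurable (completion (\<mu> \<Otimes>\<^sub>M \<mu>)) \<and> (\<forall>U. open U \<longrightarrow> omega_open \<mu> (g -` U))"

definition N_map :: "('a :: group_add \<Rightarrow> complex) \<Rightarrow> 'a \<times> 'a \<Rightarrow> complex" where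
  "N_map f = (\<lambda>(s, t). f (s - t))"

end

theory Submission
  imports Defs
begin

text \<open>
  The easy implications are topological and measure-theoretic routine: if \<open>g\<close> is continuous, then
  \<open>N_map g\<close> is continuous, and an open subset of the second countable space \<open>G \<times> G\<close> is a countable
  union of open rectangles; and by Fubini and invariance, \<open>N_map\<close> respects almost everywhere
  equality.

  For the hard implications, let \<open>\<psi>\<close> be \<open>\<omega>\<close>-continuous and almost everywhere equal to \<open>N_map f\<close>.
  The function \<open>N_map f\<close> is constant, with value \<open>f x\<close>, on each translated diagonal
  \<open>{(x + t, t)}\<close>. A marginally null set is much thinner than a general null set: it meets \<^emph>\<open>every\<close> one
  of these diagonals in a null set of parameters \<open>t\<close>. Hence whether the diagonal at \<open>x\<close> meets
  \<open>\<psi> -` U\<close> in a non-null set is decided by the countably many rectangles \<open>A \<times> B\<close> that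
  represent \<open>\<psi> -` U\<close>. For one rectangle the question is whether \<open>(A - x) \<inter> B\<close> is non-null, which
  is an open condition on \<open>x\<close> by a Steinhaus argument (lemma \<open>steinhaus\<close>). So the set \<open>P U\<close> of
  all \<open>x\<close> whose diagonal meets \<open>\<psi> -` U\<close> in a non-null set is open whenever \<open>U\<close> is
  (lemma \<open>open_nonnull_fibres\<close>).

  If \<open>U\<close> and \<open>V\<close> are disjoint open sets, then \<open>P U \<inter> P V\<close> is open, and it is null because \<open>\<psi>\<close> is
  almost everywhere equal to \<open>f x\<close> along the diagonal at \<open>x\<close> for almost all \<open>x\<close>. Nonempty open sets
  are not null, so \<open>P U \<inter> P V\<close> is empty. Since \<open>\<complex>\<close> is Hausdorff and second countable, this
  forces \<open>\<psi>\<close> to be almost everywhere constant along \<^emph>\<open>every\<close> diagonal. If \<open>g x\<close> denotes that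
  constant, then \<open>g -` U = P U\<close> is open, so \<open>g\<close> is continuous
  (lemma \<open>omega_continuous_imp_continuous_representative\<close>). By Fubini, \<open>f = g\<close> almost everywhere.
  In the case \<open>\<psi> = N_map f\<close> the constant on the diagonal at \<open>x\<close> is \<open>f x\<close>, for every \<open>x\<close>, so \<open>f = g\<close>
  everywhere.
\<close>

section \<open>Haar measure: regularity, countable covers and translations\<close>

locale haar_space =
  fixes \<mu> :: "'g :: {topological_ab_group_add, second_countable_topology, t2_space} measure"
  assumes loc_compact: "locally_compact_space (euclidean :: 'g topology)"
    and haar: "haar_measure \<mu>"
begin

lemma sets_haar [measurable_cong]: "sets \<mu> = sets borel"
  using haar by (simp add: haar_measure_def)

lemma space_haar [simp]: "space \<mu> = UNIV"
  using sets_eq_imp_space_eq[OF sets_haar] by simp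

lemma open_sets_haar: "open U \<Longrightarrow> U \<in> sets \<mu>"
  by (simp add: sets_haar)

lemma compact_sets_haar: "compact K \<Longrightarrow> K \<in> sets \<mu>"
  by (simp add: sets_haar compact_imp_closed)

lemma emeasure_compact_finite: "compact K \<Longrightarrow> emeasure \<mu> K < \<infinity>"
  using haar unfolding haar_measure_def by (elim conjE) (erule allE, erule (1) mp)

lemma outer_regular:
  "A \<in> sets \<mu> \<Longrightarrow> emeasure \<mu> A = (INF U \<in> {U. open U \<and> A \<subseteq> U}. emeasure \<mu> U)"
  using haar unfolding haar_measure_def sets_haar by (elim conjE) (erule (1) bspec)

lemma inner_regular_open:
  "open U \<Longrightarrow> emeasure \<mu> U = (SUP K \<in> {K. compact K \<and> K \<subseteq> U}. emeasure \<mu> K)"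
  using haar unfolding haar_measure_def
  by (elim conjE) (erule allE[of "\<lambda>U. open U \<longrightarrow> _ U" U], erule (1) mp)

lemma countable_compact_cover:
  "\<exists>\<K> :: 'g set set. countable \<K> \<and> (\<forall>K\<in>\<K>. compact K) \<and> \<Union>\<K> = UNIV"
proof -
  have "\<forall>x :: 'g. \<exists>U K. open U \<and> compact K \<and> x \<in> U \<and> U \<subseteq> K"
    using loc_compact by (simp add: locally_compact_space_def)
  then obtain U K :: "'g \<Rightarrow> 'g set"
    where UK: "\<And>x. open (U x)" "\<And>x. compact (K x)" "\<And>x. x \<in> U x" "\<And>x. U x \<subseteq> K x"
    by metis
  obtain \<U> where \<U>: "\<U> \<subseteq> range U" "countable \<U>" "\<Union>\<U> = \<Union>(range U)"
    using Lindelof[of "range U"] UK(1) by blast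
  obtain I where I: "countable I" "\<U> = U ` I"
    using \<U>(1,2) countable_subset_image[of \<U> U UNIV] by auto
  have "\<Union>(K ` I) = UNIV"
  proof -
    have "x \<in> \<Union>(K ` I)" for x
    proof -
      have "x \<in> \<Union>\<U>"
        using \<U>(3) UK(3)[of x] by blast
      then show ?thesis
        using I(2) UK(4) by blast
    qed
    then show ?thesis by blast
  qed
  moreover have "countable (K ` I)" "\<forall>L \<in> K ` I. compact L"
    using I(1) UK(2) by auto
  ultimately show ?thesis
    by (intro exI[of _ "K ` I"] conjI)
qed

text \<open>Makes Fubini's theorem available: a countable cover by compact sets has members of finite
  measure.\<close>

sublocale sigma_finite_measure \<mu>
proof
  obtain \<K> :: "'g set set"
    where \<K>: "countable \<K>" "\<And>K. K \<in> \<K> \<Longrightarrow> compact K" "\<Union>\<K> = UNIV"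
    using countable_compact_cover by metis
  have "\<forall>K\<in>\<K>. emeasure \<mu> K \<noteq> \<infinity>"
    using emeasure_compact_finite \<K>(2) by (simp add: less_top[symmetric])
  then show "\<exists>A. countable A \<and> A \<subseteq> sets \<mu> \<and> \<Union> A = space \<mu> \<and> (\<forall>a\<in>A. emeasure \<mu> a \<noteq> \<infinity>)"
    using \<K> compact_sets_haar by (intro exI[of _ \<K>]) (simp add: subset_eq)
qed

sublocale pair_sigma_finite \<mu> \<mu> ..

lemma sets_haar_pair: "sets (\<mu> \<Otimes>\<^sub>M \<mu>) = sets borel"
  by (simp add: borel_prod[symmetric] sets_haar cong: sets_pair_measure_cong)

lemma translate_sets: "A \<in> sets \<mu> \<Longrightarrow> (+) x ` A \<in> sets \<mu>"
proof -
  assume A: "A \<in> sets \<mu>"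
  have "(+) x ` A = (\<lambda>t. - x + t) -` A \<inter> space borel"
    by (force simp: image_iff)
  moreover have "(\<lambda>t :: 'g. - x + t) \<in> borel \<rightarrow>\<^sub>M borel"
    by (intro borel_measurable_continuous_onI continuous_intros)
  ultimately show ?thesis
    using A measurable_sets[of "\<lambda>t. - x + t" borel borel A] by (simp add: sets_haar)
qed

lemma emeasure_translate: "A \<in> sets \<mu> \<Longrightarrow> emeasure \<mu> ((+) x ` A) = emeasure \<mu> A"
  using haar by (simp add: haar_measure_def)

lemma AE_translate:
  assumes "AE t in \<mu>. P t"
  shows "AE t in \<mu>. P (x + t)"
proof -
  obtain N where N: "N \<in> null_sets \<mu>" "{t. \<not> P t} \<subseteq> N"
    using assms by (auto simp: eventually_ae_filter)
  have "(+) (- x) ` N \<in> null_sets \<mu>"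
    using N(1) translate_sets[of N "- x"] emeasure_translate[of N "- x"]
    by (simp only: null_sets_def mem_Collect_eq)
  moreover have "{t \<in> space \<mu>. \<not> P (x + t)} \<subseteq> (+) (- x) ` N"
  proof
    fix t assume "t \<in> {t \<in> space \<mu>. \<not> P (x + t)}"
    then have "x + t \<in> N"
      using N(2) by auto
    then show "t \<in> (+) (- x) ` N"
      by (rule rev_image_eqI) simp
  qed
  ultimately show ?thesis
    by (rule AE_I')
qed

lemma not_AE_False: "\<not> (AE t in \<mu>. False)"
  using haar by (auto simp: eventually_ae_filter haar_measure_def null_sets_def top.extremum_unique)

lemma AE_const: "(AE t in \<mu>. P) \<longleftrightarrow> P"
  using not_AE_False by (cases P) auto

text \<open>The shear \<open>(x, t) \<mapsto> (x + t, t)\<close> translates each horizontal section, so it preserves null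
  sets of the product. Therefore a property that holds almost everywhere in the plane holds almost
  everywhere on almost every translated diagonal.\<close>

lemma AE_translated_diagonal:
  assumes "AE p in \<mu> \<Otimes>\<^sub>M \<mu>. P p"
  shows "AE x in \<mu>. AE t in \<mu>. P (x + t, t)"
proof -
  obtain N where N: "N \<in> null_sets (\<mu> \<Otimes>\<^sub>M \<mu>)" "{p \<in> space (\<mu> \<Otimes>\<^sub>M \<mu>). \<not> P p} \<subseteq> N"
    using assms by (auto simp: eventually_ae_filter)
  have sp: "space (\<mu> \<Otimes>\<^sub>M \<mu>) = UNIV"
    by (simp add: space_pair_measure)
  have Nb: "N \<in> sets borel"
    using N(1) sets_haar_pair by auto
  have meas: "{p. (fst p + snd p, snd p) \<notin> N} \<in> sets (\<mu> \<Otimes>\<^sub>M \<mu>)"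
  proof -
    have "(\<lambda>p :: 'g \<times> 'g. (fst p + snd p, snd p)) \<in> borel \<rightarrow>\<^sub>M borel"
      by (intro borel_measurable_continuous_onI continuous_intros)
    from measurable_sets[OF this, of "- N"] Nb show ?thesis
      by (simp add: sets_haar_pair vimage_def)
  qed
  have "AE p in \<mu> \<Otimes>\<^sub>M \<mu>. p \<notin> N"
    by (rule AE_not_in[OF N(1)])
  moreover have "{p \<in> space (\<mu> \<Otimes>\<^sub>M \<mu>). (fst p, snd p) \<notin> N} \<in> sets (\<mu> \<Otimes>\<^sub>M \<mu>)"
    using Nb by (simp add: sp sets_haar_pair Collect_neg_eq)
  ultimately have "AE t in \<mu>. AE s in \<mu>. (s, t) \<notin> N"
    using AE_commute[of "\<lambda>s t. (s, t) \<notin> N"] AE_pair[of "\<lambda>p. p \<notin> N"] by simp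
  then have "AE t in \<mu>. AE x in \<mu>. (x + t, t) \<notin> N"
  proof eventually_elim
    fix t assume "AE s in \<mu>. (s, t) \<notin> N"
    from AE_translate[OF this, of t] show "AE x in \<mu>. (x + t, t) \<notin> N"
      by (simp add: add.commute)
  qed
  then have "AE x in \<mu>. AE t in \<mu>. (x + t, t) \<notin> N"
    using AE_commute[of "\<lambda>x t. (x + t, t) \<notin> N"] meas by (simp add: sp)
  then show ?thesis
  proof eventually_elim
    fix x assume "AE t in \<mu>. (x + t, t) \<notin> N"
    then show "AE t in \<mu>. P (x + t, t)"
      by (rule AE_mp) (use N(2) sp in auto)
  qed
qed

lemma AE_N_map:
  assumes "AE x in \<mu>. f x = g x"
  shows "AE p in \<mu> \<Otimes>\<^sub>M \<mu>. N_map f p = N_map g p"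
proof -
  obtain N where N: "N \<in> null_sets \<mu>" "{x. f x \<noteq> g x} \<subseteq> N"
    using assms by (auto simp: eventually_ae_filter)
  have "AE p in \<mu> \<Otimes>\<^sub>M \<mu>. (case p of (s, t) \<Rightarrow> s - t \<notin> N)"
  proof -
    have "(\<lambda>p :: 'g \<times> 'g. fst p - snd p) \<in> borel \<rightarrow>\<^sub>M borel"
      by (intro borel_measurable_continuous_onI continuous_intros)
    moreover have "N \<in> sets borel"
      using N(1) sets_haar by auto
    ultimately have meas: "{p. fst p - snd p \<notin> N} \<in> sets (\<mu> \<Otimes>\<^sub>M \<mu>)"
      using measurable_sets[of "\<lambda>p. fst p - snd p" borel borel "- N"]
      by (simp add: sets_haar_pair vimage_def)
    have "AE t in \<mu>. AE s in \<mu>. s - t \<notin> N"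
      using AE_translate[OF AE_not_in[OF N(1)], of "- t" for t]
      by (simp only: uminus_add_conv_diff) simp
    then show ?thesis
      using AE_commute[of "\<lambda>s t. s - t \<notin> N"] AE_pair_iff[of "\<lambda>s t. s - t \<notin> N"] meas
      by (simp add: space_pair_measure case_prod_unfold)
  qed
  then show ?thesis
    by (rule AE_mp) (use N(2) in \<open>auto intro!: AE_I2 simp: N_map_def\<close>)
qed

section \<open>A Steinhaus theorem\<close>

text \<open>If \<open>C\<close> has finite measure, then most of it sits in a compact subset \<open>K\<close> of an open set \<open>U\<close>
  that is barely larger than \<open>C\<close>, and \<open>U\<close> has no room for two almost disjoint copies of
  \<open>C \<inter> K\<close>. In detail, a part
  \<open>D\<close> of \<open>C\<close> of finite measure \<open>a\<close> lies in an open \<open>U\<close> of measure less than \<open>5a/4\<close>, and \<open>U\<close> contains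
  a compact \<open>K\<close> that misses less than \<open>a/4\<close> of it. Then \<open>E = D \<inter> K\<close> has measure more than \<open>3a/4\<close>, and
  small translates of \<open>K\<close>, hence of \<open>E\<close>, stay inside \<open>U\<close>. If \<open>E\<close> and its translate were almost
  disjoint, \<open>U\<close> would have measure more than \<open>6a/4\<close>.\<close>

lemma steinhaus:
  assumes C: "C \<in> sets \<mu>" "\<not> (AE t in \<mu>. t \<notin> C)"
  obtains V where "open V" "0 \<in> V" "\<And>h. h \<in> V \<Longrightarrow> \<not> (AE t in \<mu>. \<not> (t \<in> C \<and> h + t \<in> C))"
proof -
  obtain \<K> :: "'g set set"
    where \<K>: "countable \<K>" "\<And>K. K \<in> \<K> \<Longrightarrow> compact K" "\<Union>\<K> = UNIV"
    using countable_compact_cover by metis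
  obtain L where L: "L \<in> \<K>" "\<not> (AE t in \<mu>. t \<notin> C \<inter> L)"
  proof (rule ccontr)
    assume "\<not> thesis"
    then have "AE t in \<mu>. \<forall>L\<in>\<K>. t \<notin> C \<inter> L"
      using that \<K>(1) by (intro AE_ball_countable') auto
    then have "AE t in \<mu>. t \<notin> C"
      by (rule AE_mp) (use \<K>(3) in \<open>auto intro!: AE_I2\<close>)
    with C(2) show False by blast
  qed
  define D where "D = C \<inter> L"
  have D: "D \<in> sets \<mu>"
    using C(1) compact_sets_haar[OF \<K>(2)[OF L(1)]] by (auto simp: D_def)
  have "emeasure \<mu> L < \<infinity>"
    by (rule emeasure_compact_finite[OF \<K>(2)[OF L(1)]])
  moreover have "emeasure \<mu> D \<le> emeasure \<mu> L"
    using compact_sets_haar[OF \<K>(2)[OF L(1)]] by (intro emeasure_mono) (auto simp: D_def)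
  ultimately have "emeasure \<mu> D \<noteq> \<infinity>" by auto
  then have Deq: "emeasure \<mu> D = ennreal (measure \<mu> D)"
    by (simp add: emeasure_eq_ennreal_measure)
  define a where "a = measure \<mu> D"
  have "a \<noteq> 0"
    using L(2) D Deq AE_not_in[of D \<mu>] by (auto simp: a_def D_def null_sets_def)
  then have a: "a > 0"
    by (simp add: a_def zero_less_measure_iff)
  have "(INF U \<in> {U. open U \<and> D \<subseteq> U}. emeasure \<mu> U) = emeasure \<mu> D"
    by (rule outer_regular[OF D, symmetric])
  also have "\<dots> < ennreal (a + a / 4)"
    using a Deq by (simp add: a_def ennreal_less_iff)
  finally obtain U where U: "open U" "D \<subseteq> U" "emeasure \<mu> U < ennreal (a + a / 4)"
    by (auto simp: INF_less_iff)
  have Ufin: "emeasure \<mu> U \<noteq> \<infinity>"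
    using U(3) by auto
  then have Ueq: "emeasure \<mu> U = ennreal (measure \<mu> U)"
    by (simp add: emeasure_eq_ennreal_measure)
  have u: "measure \<mu> U < a + a / 4"
    using U(3) Ueq by (simp add: ennreal_less_iff)
  have aU: "a \<le> measure \<mu> U"
    unfolding a_def using Ufin U(2) D open_sets_haar[OF U(1)]
    by (intro measure_mono_fmeasurable) (auto simp: fmeasurable_def top.not_eq_extremum)
  have "ennreal (measure \<mu> U - a / 4) < emeasure \<mu> U"
    using a aU Ueq by (simp add: ennreal_less_iff)
  also have "\<dots> = (SUP K \<in> {K. compact K \<and> K \<subseteq> U}. emeasure \<mu> K)"
    by (rule inner_regular_open[OF U(1)])
  finally obtain K where K: "compact K" "K \<subseteq> U" "ennreal (measure \<mu> U - a / 4) < emeasure \<mu> K"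
    by (auto simp: less_SUP_iff)
  have fmU: "U \<in> fmeasurable \<mu>"
    using Ufin open_sets_haar[OF U(1)] by (auto simp: fmeasurable_def top.not_eq_extremum)
  have fm: "A \<in> fmeasurable \<mu>" if "A \<subseteq> U" "A \<in> sets \<mu>" for A
    using fmeasurableI2[OF fmU] that by blast
  have Ks: "K \<in> sets \<mu>"
    by (rule compact_sets_haar[OF K(1)])
  have "emeasure \<mu> K = ennreal (measure \<mu> K)"
    using fm[OF K(2) Ks] by (simp add: emeasure_eq_measure2)
  then have k: "measure \<mu> U - a / 4 < measure \<mu> K"
    using K(3) a aU by (simp add: ennreal_less_iff)
  define E where "E = D \<inter> K"
  have E: "E \<in> sets \<mu>" "E \<subseteq> U"
    using D Ks K(2) by (auto simp: E_def)
  have "measure \<mu> D \<le> measure \<mu> (E \<union> (U - K))"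
  proof (rule measure_mono_fmeasurable)
    show "D \<subseteq> E \<union> (U - K)"
      using U(2) by (auto simp: E_def)
    show "E \<union> (U - K) \<in> fmeasurable \<mu>"
    proof (rule fm)
      show "E \<union> (U - K) \<subseteq> U"
        using E(2) by blast
      show "E \<union> (U - K) \<in> sets \<mu>"
        by (intro sets.Un sets.Diff E(1) Ks open_sets_haar U(1))
    qed
  qed (rule D)
  also have "\<dots> \<le> measure \<mu> E + measure \<mu> (U - K)"
    by (intro measure_Un_le sets.Diff E(1) Ks open_sets_haar U(1))
  also have "measure \<mu> (U - K) = measure \<mu> U - measure \<mu> K"
    using Ufin by (intro measure_Diff Ks K(2) open_sets_haar U(1)) simp
  finally have e: "measure \<mu> E > 3 * a / 4"
    using k by (simp add: a_def)
  have "\<exists>V. 0 \<in> V \<and> open V \<and> V \<times> K \<subseteq> (\<lambda>p. - fst p + snd p) -` U"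
  proof (rule Elementary_Topology.tube_lemma[OF K(1)])
    show "open ((\<lambda>p :: 'g \<times> 'g. - fst p + snd p) -` U)"
      by (intro open_vimage U(1) continuous_intros)
    show "{0} \<times> K \<subseteq> (\<lambda>p. - fst p + snd p) -` U"
      using K(2) by auto
  qed
  then obtain V where V: "0 \<in> V" "open V" "V \<times> K \<subseteq> (\<lambda>p. - fst p + snd p) -` U"
    by blast
  show thesis
  proof (rule that[OF V(2,1)], rule notI)
    fix h assume h: "h \<in> V" and ae: "AE t in \<mu>. \<not> (t \<in> C \<and> h + t \<in> C)"
    define F where "F = (+) (- h) ` E"
    have F: "F \<in> sets \<mu>" "F \<subseteq> U"
      using translate_sets[OF E(1)] V(3) h by (auto simp only: F_def) (auto simp: E_def)
    have mF: "measure \<mu> F = measure \<mu> E"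
      using emeasure_translate[OF E(1)] by (simp only: F_def measure_def)
    have "measure \<mu> (E \<union> F) = measure \<mu> E + measure \<mu> F"
    proof (rule measure_Un_AE)
      show "AE t in \<mu>. t \<notin> E \<or> t \<notin> F"
        using ae by eventually_elim (auto simp: E_def F_def D_def)
    qed (intro fm E F)+
    moreover have "measure \<mu> (E \<union> F) \<le> measure \<mu> U"
      by (intro measure_mono_fmeasurable fmU sets.Un E F Un_least)
    ultimately show False
      using mF e u a by linarith
  qed
qed

text \<open>By the Lindeloef property, countably many translates of a nonempty open set cover the whole
  group, which is not null.\<close>

lemma nonempty_open_not_null:
  assumes "open V" "V \<noteq> {}"
  shows "\<not> (AE t in \<mu>. t \<notin> V)"
proof
  assume ae: "AE t in \<mu>. t \<notin> V"
  define T where "T x = (\<lambda>t. - x + t) -` V" for x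
  have T: "open (T x)" for x
    unfolding T_def by (intro open_vimage assms continuous_intros)
  obtain \<U> where \<U>: "\<U> \<subseteq> range T" "countable \<U>" "\<Union>\<U> = \<Union>(range T)"
    using Lindelof[of "range T"] T by blast
  obtain v where v: "v \<in> V"
    using assms by blast
  have "t \<in> T (t - v)" for t
    using v by (simp add: T_def)
  then have cover: "\<Union>\<U> = UNIV"
    using \<U>(3) by blast
  have "AE t in \<mu>. \<forall>W\<in>\<U>. t \<notin> W"
  proof (rule AE_ball_countable'[OF _ \<U>(2)])
    fix W assume "W \<in> \<U>"
    then obtain x where "W = T x"
      using \<U>(1) by blast
    then show "AE t in \<mu>. t \<notin> W"
      using AE_translate[OF ae, of "- x"] by (simp add: T_def)
  qed
  then have "AE t in \<mu>. False"
    by (rule AE_mp) (use cover in \<open>auto intro!: AE_I2\<close>)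
  then show False
    using not_AE_False by blast
qed

section \<open>Diagonal fibres of \<open>\<omega>\<close>-open sets\<close>

text \<open>Let \<open>C = (A - x) \<inter> B\<close> be the fibre at \<open>x\<close>. If both \<open>t\<close> and \<open>(y - x) + t\<close> lie in \<open>C\<close>, then
  \<open>t \<in> B\<close> and \<open>y + t \<in> A\<close>. So the fibre at \<open>y\<close> contains the overlap of \<open>C\<close> with a translate of
  itself, and this overlap is non-null for \<open>y\<close> near \<open>x\<close>.\<close>

lemma open_nonnull_fibres_rectangle:
  assumes A: "A \<in> sets (completion \<mu>)" and B: "B \<in> sets (completion \<mu>)"
  shows "open {x. \<not> (AE t in \<mu>. (x + t, t) \<notin> A \<times> B)}"
proof (subst open_subopen, intro ballI)
  fix x assume x: "x \<in> {x. \<not> (AE t in \<mu>. (x + t, t) \<notin> A \<times> B)}"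
  (* The Steinhaus argument is about Borel sets; passing to Borel parts of A and B changes each
     fibre by a null set only. *)
  define A' B' where "A' = main_part \<mu> A" and "B' = main_part \<mu> B"
  have s: "A' \<in> sets \<mu>" "B' \<in> sets \<mu>"
    using A B by (auto simp: A'_def B'_def)
  have A': "AE t in \<mu>. y + t \<in> A' \<longleftrightarrow> y + t \<in> A" for y
    unfolding A'_def by (rule AE_translate[OF AE_in_main_part[OF A]])
  have B': "AE t in \<mu>. t \<in> B' \<longleftrightarrow> t \<in> B"
    unfolding B'_def by (rule AE_in_main_part[OF B])
  define C where "C = (+) (- x) ` A' \<inter> B'"
  have C_iff: "t \<in> C \<longleftrightarrow> x + t \<in> A' \<and> t \<in> B'" for t
  proof -
    have "t \<in> (+) (- x) ` A' \<longleftrightarrow> x + t \<in> A'"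
      by (force simp: image_iff)
    then show ?thesis
      by (simp add: C_def)
  qed
  have C: "C \<in> sets \<mu>"
    unfolding C_def using s translate_sets by blast
  have nn: "\<not> (AE t in \<mu>. t \<notin> C)"
  proof
    assume "AE t in \<mu>. t \<notin> C"
    then have "AE t in \<mu>. (x + t, t) \<notin> A \<times> B"
      using A'[of x] B' by eventually_elim (auto simp: C_iff)
    with x show False by blast
  qed
  obtain V where V: "open V" "0 \<in> V"
    "\<And>h. h \<in> V \<Longrightarrow> \<not> (AE t in \<mu>. \<not> (t \<in> C \<and> h + t \<in> C))"
    using steinhaus[OF C nn] by blast
  have "(\<lambda>y. y - x) -` V \<subseteq> {x. \<not> (AE t in \<mu>. (x + t, t) \<notin> A \<times> B)}"
  proof safe
    fix y assume y: "y - x \<in> V" and ae: "AE t in \<mu>. (y + t, t) \<notin> A \<times> B"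
    have "AE t in \<mu>. \<not> (t \<in> C \<and> (y - x) + t \<in> C)"
      using ae A'[of y] B' by eventually_elim (auto simp: C_iff algebra_simps)
    with V(3)[OF y] show False by blast
  qed
  moreover have "open ((\<lambda>y. y - x) -` V)"
    by (intro open_vimage V(1) continuous_intros)
  ultimately show "\<exists>T. open T \<and> x \<in> T \<and> T \<subseteq> {x. \<not> (AE t in \<mu>. (x + t, t) \<notin> A \<times> B)}"
    using V(2) by (intro exI[of _ "(\<lambda>y. y - x) -` V"]) auto
qed

text \<open>Both coordinates \<open>x + t\<close> and \<open>t\<close> of the diagonal avoid any given null set for almost all \<open>t\<close>.
  This is where marginally null is stronger than null: the conclusion holds for every \<open>x\<close>, not
  just for almost every \<open>x\<close>.\<close>

lemma marginally_null_fibres: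
  assumes "marginally_null \<mu> E"
  shows "AE t in \<mu>. (x + t, t) \<notin> E"
proof -
  obtain X Y where XY: "X \<in> null_sets (completion \<mu>)" "Y \<in> null_sets (completion \<mu>)"
    "E \<subseteq> (X \<times> UNIV) \<union> (UNIV \<times> Y)"
    using assms by (auto simp: marginally_null_def)
  have "AE t in \<mu>. x + t \<notin> X"
    using AE_translate AE_not_in[OF XY(1)] AE_completion_iff by blast
  moreover have "AE t in \<mu>. t \<notin> Y"
    using AE_not_in[OF XY(2)] AE_completion_iff by blast
  ultimately show ?thesis
    by eventually_elim (use XY(3) in auto)
qed

text \<open>The diagonal fibre at \<open>x\<close> agrees up to a null set with a countable union of fibres of rectangles,
  so it is non-null if and only if one of those is.\<close>

lemma open_nonnull_fibres:
  assumes "omega_open \<mu> W"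
  shows "open {x. \<not> (AE t in \<mu>. (x + t, t) \<notin> W)}"
proof -
  obtain \<R> where \<R>: "countable \<R>" "\<R> \<subseteq> rectangles \<mu>"
    "marginally_null \<mu> ((W - \<Union>\<R>) \<union> (\<Union>\<R> - W))"
    using assms by (auto simp: omega_open_def)
  have "(AE t in \<mu>. (x + t, t) \<notin> W) \<longleftrightarrow> (AE t in \<mu>. \<forall>R\<in>\<R>. (x + t, t) \<notin> R)" for x
  proof (rule iffI)
    have n: "AE t in \<mu>. (x + t, t) \<notin> (W - \<Union>\<R>) \<union> (\<Union>\<R> - W)"
      by (rule marginally_null_fibres[OF \<R>(3)])
    show "AE t in \<mu>. \<forall>R\<in>\<R>. (x + t, t) \<notin> R" if "AE t in \<mu>. (x + t, t) \<notin> W"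
      using n that by eventually_elim auto
    show "AE t in \<mu>. (x + t, t) \<notin> W" if "AE t in \<mu>. \<forall>R\<in>\<R>. (x + t, t) \<notin> R"
      using n that by eventually_elim auto
  qed
  then have "{x. \<not> (AE t in \<mu>. (x + t, t) \<notin> W)} = (\<Union>R\<in>\<R>. {x. \<not> (AE t in \<mu>. (x + t, t) \<notin> R)})"
    by (auto simp: AE_ball_countable[OF \<R>(1)])
  moreover have "open {x. \<not> (AE t in \<mu>. (x + t, t) \<notin> R)}" if "R \<in> \<R>" for R
    using that \<R>(2) open_nonnull_fibres_rectangle by (auto simp: rectangles_def)
  ultimately show ?thesis by auto
qed

section \<open>Continuity along the diagonals\<close>

text \<open>The value \<open>g x\<close> is the essential constant value of \<open>\<psi>\<close> along the diagonal at \<open>x\<close>. Keeping it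
  in the conclusion for every \<open>x\<close> is what identifies \<open>g\<close> with \<open>f\<close> everywhere if \<open>\<psi> = N_map f\<close>.\<close>

lemma omega_continuous_imp_continuous_representative:
  assumes \<psi>: "omega_continuous \<mu> \<psi>"
    and f: "AE p in \<mu> \<Otimes>\<^sub>M \<mu>. N_map f p = \<psi> p"
  obtains g where "continuous_on UNIV g" "\<And>x. AE t in \<mu>. \<psi> (x + t, t) = g x"
proof -
  define P where "P U = {x. \<not> (AE t in \<mu>. \<psi> (x + t, t) \<notin> U)}" for U
  have openP: "open (P U)" if "open U" for U
    using open_nonnull_fibres[of "\<psi> -` U"] \<psi> that by (simp add: P_def omega_continuous_def)
  have good: "AE x in \<mu>. AE t in \<mu>. f x = \<psi> (x + t, t)"
    using AE_translated_diagonal[OF f] by (simp add: N_map_def)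
  have disj: "P U \<inter> P V = {}" if UV: "open U" "open V" "U \<inter> V = {}" for U V
  proof (rule ccontr)
    assume ne: "P U \<inter> P V \<noteq> {}"
    have "AE x in \<mu>. x \<notin> P U \<inter> P V"
      using good
    proof eventually_elim
      fix x assume x: "AE t in \<mu>. f x = \<psi> (x + t, t)"
      have "f x \<in> S" if "x \<in> P S" for S
      proof (rule ccontr)
        assume S: "f x \<notin> S"
        have "AE t in \<mu>. \<psi> (x + t, t) \<notin> S"
          using x by eventually_elim (use S in auto)
        with that show False by (simp add: P_def)
      qed
      then show "x \<notin> P U \<inter> P V"
        using UV(3) by blast
    qed
    then show False
      using nonempty_open_not_null[OF _ ne] openP UV(1,2) by blast
  qed
  have "\<exists>c. AE t in \<mu>. \<psi> (x + t, t) = c" for x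
  proof -
    (* The union of \<U> is the complement of the essential range of \<psi> along the diagonal at x: it is
       avoided almost everywhere, and what remains is exactly one point. *)
    define \<U> where "\<U> = {U. open U \<and> x \<notin> P U}"
    have "open U" if "U \<in> \<U>" for U
      using that by (simp add: \<U>_def)
    then obtain \<V> where \<V>: "\<V> \<subseteq> \<U>" "countable \<V>" "\<Union>\<V> = \<Union>\<U>"
      by (rule Lindelof[of \<U>])
    have "AE t in \<mu>. \<forall>U\<in>\<V>. \<psi> (x + t, t) \<notin> U"
    proof (rule AE_ball_countable'[OF _ \<V>(2)])
      fix U assume "U \<in> \<V>"
      then have "U \<in> \<U>"
        using \<V>(1) by blast
      then show "AE t in \<mu>. \<psi> (x + t, t) \<notin> U"
        by (simp add: \<U>_def P_def)
    qed
    then have ae: "AE t in \<mu>. \<psi> (x + t, t) \<notin> \<Union>\<U>"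
      unfolding \<V>(3)[symmetric] by eventually_elim blast
    have uniq: "c = d" if "c \<notin> \<Union>\<U>" "d \<notin> \<Union>\<U>" for c d
    proof (rule ccontr)
      assume "c \<noteq> d"
      then obtain U V where UV: "open U" "open V" "c \<in> U" "d \<in> V" "U \<inter> V = {}"
        using hausdorff[of c d] by metis
      have "U \<notin> \<U>" "V \<notin> \<U>"
        using that UV(3,4) by blast+
      then have "x \<in> P U \<inter> P V"
        using UV(1,2) by (simp add: \<U>_def)
      with disj[OF UV(1,2,5)] show False by simp
    qed
    show ?thesis
    proof (cases "\<exists>c. c \<notin> \<Union>\<U>")
      case True
      then obtain c where c: "c \<notin> \<Union>\<U>" by blast
      have "AE t in \<mu>. \<psi> (x + t, t) = c"
        using ae by eventually_elim (rule uniq[OF _ c])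
      then show ?thesis by blast
    next
      case False
      then have "AE t in \<mu>. False"
        using ae by auto
      then show ?thesis
        using not_AE_False by blast
    qed
  qed
  then obtain g where g: "\<And>x. AE t in \<mu>. \<psi> (x + t, t) = g x"
    by metis
  have "g -` U = P U" for U
  proof (rule set_eqI)
    fix x
    have "(AE t in \<mu>. \<psi> (x + t, t) \<notin> U) \<longleftrightarrow> (AE t in \<mu>. g x \<notin> U)"
    proof
      assume "AE t in \<mu>. \<psi> (x + t, t) \<notin> U"
      then show "AE t in \<mu>. g x \<notin> U"
        using g[of x] by eventually_elim auto
    next
      assume "AE t in \<mu>. g x \<notin> U"
      then show "AE t in \<mu>. \<psi> (x + t, t) \<notin> U"
        using g[of x] by eventually_elim auto
    qed
    then show "x \<in> g -` U \<longleftrightarrow> x \<in> P U"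
      unfolding P_def by (simp add: AE_const)
  qed
  then have "continuous_on UNIV g"
    using openP by (auto simp: continuous_on_open_vimage)
  then show thesis
    using that g by blast
qed

section \<open>From continuity to \<open>\<omega>\<close>-continuity\<close>

lemma omega_open_of_open:
  fixes W :: "('g \<times> 'g) set"
  assumes "open W"
  shows "omega_open \<mu> W"
proof -
  obtain \<B> :: "'g set set" where \<B>: "countable \<B>" "topological_basis \<B>"
    using ex_countable_basis by blast
  define \<R> where "\<R> = {R \<in> (\<lambda>(a, b). a \<times> b) ` (\<B> \<times> \<B>). R \<subseteq> W}"
  have "countable \<R>"
    using \<B>(1) by (auto simp: \<R>_def intro: countable_subset)
  moreover have "\<R> \<subseteq> rectangles \<mu>"
  proof -
    have "b \<in> sets (completion \<mu>)" if "b \<in> \<B>" for b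
      using topological_basis_open[OF \<B>(2) that] open_sets_haar by auto
    then show ?thesis
      by (auto simp: \<R>_def rectangles_def)
  qed
  moreover have "\<Union>\<R> = W"
  proof -
    obtain \<S> where \<S>: "\<S> \<subseteq> (\<lambda>(a, b). a \<times> b) ` (\<B> \<times> \<B>)" "\<Union>\<S> = W"
      using topological_basis_prod[OF \<B>(2) \<B>(2)] assms
      unfolding topological_basis_def by metis
    have "S \<in> \<R>" if "S \<in> \<S>" for S
      using that \<S> unfolding \<R>_def by blast
    then have "W \<subseteq> \<Union>\<R>"
      unfolding \<S>(2)[symmetric] by (intro Union_mono subsetI)
    moreover have "\<Union>\<R> \<subseteq> W"
      by (rule Union_least) (simp add: \<R>_def)
    ultimately show ?thesis
      by (rule subset_antisym[rotated])
  qed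
  moreover have "marginally_null \<mu> {}"
    by (auto simp: marginally_null_def)
  ultimately show ?thesis
    unfolding omega_open_def by (intro exI[of _ \<R>]) simp
qed

lemma continuous_imp_omega_continuous:
  assumes "continuous_on UNIV g"
  shows "omega_continuous \<mu> (N_map g)"
proof -
  have c: "continuous_on UNIV (N_map g)"
    unfolding N_map_def case_prod_unfold
    by (intro continuous_on_compose2[OF assms] continuous_intros) auto
  have "N_map g \<in> borel_measurable (\<mu> \<Otimes>\<^sub>M \<mu>)"
    using borel_measurable_continuous_onI[OF c] measurable_cong_sets[OF sets_haar_pair refl] by blast
  moreover have "omega_open \<mu> (N_map g -` U)" if "open U" for U
    using c that by (intro omega_open_of_open) (auto simp: continuous_on_open_vimage)
  ultimately show ?thesis
    by (auto simp: omega_continuous_def measurable_completion)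
qed

end

theorem proposition7p3:
  fixes \<mu> :: "'g :: {topological_ab_group_add, second_countable_topology, t2_space} measure"
    and f :: "'g \<Rightarrow> complex"
    and \<phi> :: "'g \<times> 'g \<Rightarrow> complex"
  assumes "locally_compact_space (euclidean :: 'g topology)"
    and "haar_measure \<mu>"
    and "f \<in> borel_measurable (completion \<mu>)"
    and "\<phi> = N_map f"
  shows "((\<exists>\<psi>. omega_continuous \<mu> \<psi> \<and> (AE p in \<mu> \<Otimes>\<^sub>M \<mu>. \<phi> p = \<psi> p)) \<longleftrightarrow>
          (\<exists>g. continuous_on UNIV g \<and> (AE x in \<mu>. f x = g x)))
       \<and> (omega_continuous \<mu> \<phi> \<longleftrightarrow> continuous_on UNIV f)"
proof -
  interpret haar_space \<mu>
    by (rule haar_space.intro) fact+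
  show ?thesis
  proof (intro conjI iffI)
    assume "\<exists>\<psi>. omega_continuous \<mu> \<psi> \<and> (AE p in \<mu> \<Otimes>\<^sub>M \<mu>. \<phi> p = \<psi> p)"
    then obtain \<psi> where \<psi>: "omega_continuous \<mu> \<psi>" "AE p in \<mu> \<Otimes>\<^sub>M \<mu>. N_map f p = \<psi> p"
      using assms(4) by blast
    obtain g where g: "continuous_on UNIV g" "\<And>x. AE t in \<mu>. \<psi> (x + t, t) = g x"
      using omega_continuous_imp_continuous_representative[OF \<psi>] by blast
    have "AE x in \<mu>. f x = g x"
      using AE_translated_diagonal[OF \<psi>(2)]
    proof eventually_elim
      fix x assume "AE t in \<mu>. N_map f (x + t, t) = \<psi> (x + t, t)"
      then have "AE t in \<mu>. f x = g x"
        using g(2)[of x] by eventually_elim (simp add: N_map_def)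
      then show "f x = g x"
        by (simp only: AE_const)
    qed
    with g(1) show "\<exists>g. continuous_on UNIV g \<and> (AE x in \<mu>. f x = g x)" by blast
  next
    assume "\<exists>g. continuous_on UNIV g \<and> (AE x in \<mu>. f x = g x)"
    then show "\<exists>\<psi>. omega_continuous \<mu> \<psi> \<and> (AE p in \<mu> \<Otimes>\<^sub>M \<mu>. \<phi> p = \<psi> p)"
      unfolding assms(4) using continuous_imp_omega_continuous AE_N_map by blast
  next
    assume "omega_continuous \<mu> \<phi>"
    then have \<phi>: "omega_continuous \<mu> (N_map f)" "AE p in \<mu> \<Otimes>\<^sub>M \<mu>. N_map f p = N_map f p"
      using assms(4) by auto
    obtain g where g: "continuous_on UNIV g" "\<And>x. AE t in \<mu>. N_map f (x + t, t) = g x"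
      using omega_continuous_imp_continuous_representative[OF \<phi>] by blast
    have "f x = g x" for x
      using g(2)[of x] by (simp add: N_map_def AE_const)
    then have "f = g" by blast
    with g(1) show "continuous_on UNIV f" by simp
  next
    assume "continuous_on UNIV f"
    then show "omega_continuous \<mu> \<phi>"
      unfolding assms(4) by (rule continuous_imp_omega_continuous)
  qed
qed

end
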